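(* Let $f\in C^2([0,1])$ satisfy $f(0)=f(1)=0$ and $0<f(s)\le f'(0)s$ for all $s\in(0,1)$, extended linearly to $\mathbb{R}\setminus[0,1]$. Let $\lambda_*=\sqrt{f'(0)}$, fix $\lambda\in(0,\lambda_* )$ and set $c=\lambda+f'(0)/\lambda$. Let $u_0:\mathbb{R}\to[0,1]$ be continuous and not identically zero, and suppose there exist $\nu\in\mathbb{R}$ and constants $0<a_1\le a_2$ such that $a_1x^{\nu}e^{-\lambda x}\le u_0(x)\le a_2x^{\nu}e^{-\lambda x}$ for all sufficiently large $x$. Let $u$ be the solution of $u_t=u_{xx}+f(u)$, $t>0$, $x\in\mathbb{R}$, with $u(0,\cdot)=u_0$, and for $m\in(0,1)$ let $X_m(t)=\sup\{x\in\mathbb{R}: u(t,x)\ge m\}$. Then for every $m\in(0,1)$, $X_m(t)-ct-\frac{\nu}{\lambda}\ln t$ is bounded as $t\to+\infty$.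
   Context: "Extended linearly" means $f$ is extended to $\mathbb{R}$ by affine functions outside $[0,1]$. Bounded as $t\to+\infty$ means bounded for all sufficiently large $t$. *)

theory Defs
  imports "HOL-Analysis.Analysis"
begin

text \<open>Classical solution of the Cauchy problem u_t = u_xx + f(u), t > 0, x real,
  with u(0,.) = u0, within the class of bounded solutions (where it is unique).
  u t x is the value at time t and position x.\<close>
definition rd_solution :: "(real \<Rightarrow> real) \<Rightarrow> (real \<Rightarrow> real) \<Rightarrow> (real \<Rightarrow> real \<Rightarrow> real) \<Rightarrow> bool" where
  "rd_solution f u0 u \<longleftrightarrow>
     continuous_on ({0..} \<times> UNIV) (\<lambda>(t,x). u t x) \<and>
     (\<forall>x. u 0 x = u0 x) \<and>
     bounded ((\<lambda>(t,x). u t x) ` ({0..} \<times> UNIV)) \<and>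
     (\<exists>ut ux uxx.
        continuous_on ({0<..} \<times> UNIV) (\<lambda>(t,x). ut t x) \<and>
        continuous_on ({0<..} \<times> UNIV) (\<lambda>(t,x). uxx t x) \<and>
        (\<forall>t>0. \<forall>x.
           ((\<lambda>s. u s x) has_real_derivative ut t x) (at t) \<and>
           ((\<lambda>y. u t y) has_real_derivative ux t x) (at x) \<and>
           ((\<lambda>y. ux t y) has_real_derivative uxx t x) (at x) \<and>
           ut t x = uxx t x + f (u t x)))"

definition level_pos :: "(real \<Rightarrow> real \<Rightarrow> real) \<Rightarrow> real \<Rightarrow> real \<Rightarrow> real" where
  "level_pos u m t = Sup {x. u t x \<ge> m}"

end

(*
  Put Y(t,x) = (x - b t)^nu exp(-lam (x - c t)). For b = 2 lam this solves the linearised equation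
  w_t = w_xx + f'(0) w up to a term of relative size (x - b t)^(-2); moving b slightly away from
  2 lam, to the side dictated by the sign of nu, adds a larger term of relative size (x - b t)^(-1)
  and makes Y a genuine super- or subsolution on a half-line x - b t >= s0. As b < c, Y is of
  order 1 exactly when x = c t + (nu/lam) ln t + O(1).
  Upper bound: u <= C Y by comparison, since f(s) <= f'(0) s.
  Lower bound: a Y - A Y^(1+theta) is a subsolution because f(s) >= f'(0) s - M s^2, so u stays
  above a positive constant along the curve x = c t + (nu/lam) ln t - B. Behind that curve u is
  bounded below by comparison with delta (1 - exp(-sigma (x - x_0 - sigma t))), and since f > 0
  on (0,1) a paraboloid growing in time then lifts u above any m < 1 at bounded distance.
*)

theory Submission
  imports Defs "HOL-Real_Asymp.Real_Asymp"
begin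

section \<open>Parabolic maximum principle on closed space-time regions\<close>

text \<open>If \<open>d\<close> were positive, \<open>\<phi>1\<close>, which vanishes at the
  maximum, would be positive just to its right, and the mean value theorem would make
  \<open>\<phi>\<close> rise there.\<close>

lemma second_deriv_nonpos_at_max:
  fixes \<phi> :: "real \<Rightarrow> real"
  assumes e: "e > 0" and d1: "\<And>y. \<bar>y - x\<bar> < e \<Longrightarrow> (\<phi> has_real_derivative \<phi>1 y) (at y)"
    and d2: "(\<phi>1 has_real_derivative d) (at x)"
    and mx: "\<And>y. \<bar>y - x\<bar> < e \<Longrightarrow> \<phi> y \<le> \<phi> x"
  shows "d \<le> 0"
proof (rule ccontr)
  assume "\<not> d \<le> 0"
  then have "d > 0" by simp
  have "\<phi>1 x = 0"
    by (rule DERIV_local_max[OF d1[of x] e]) (use e mx in \<open>auto simp: abs_minus_commute\<close>)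
  from DERIV_pos_inc_right[OF d2 \<open>d > 0\<close>] obtain k where k: "k > 0"
    "\<And>h. h > 0 \<Longrightarrow> h < k \<Longrightarrow> \<phi>1 x < \<phi>1 (x + h)" by blast
  define h where "h = min e k / 2"
  have h: "0 < h" "h < e" "h < k" using e k by (auto simp: h_def)
  have "\<exists>z>x. z < x + h \<and> \<phi> (x + h) - \<phi> x = (x + h - x) * \<phi>1 z"
    by (rule MVT2) (use h in \<open>auto intro!: d1\<close>)
  then obtain z where z: "x < z" "z < x + h" "\<phi> (x + h) - \<phi> x = h * \<phi>1 z" by auto
  have "\<phi>1 z > 0" using k(2)[of "z - x"] z h \<open>\<phi>1 x = 0\<close> by auto
  then have "\<phi> (x + h) > \<phi> x" using z(3) h by (smt (verit) mult_pos_pos)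
  with mx[of "x + h"] h show False by auto
qed

text \<open>Only earlier times are compared, so that the lemma also applies at a maximum attained at
  the final time, where one cannot conclude that the time derivative vanishes.\<close>

lemma deriv_nonneg_at_left_max:
  fixes \<phi> :: "real \<Rightarrow> real"
  assumes e: "e > 0" and d: "(\<phi> has_real_derivative d) (at t)"
    and mx: "\<And>s. t - e < s \<Longrightarrow> s \<le> t \<Longrightarrow> \<phi> s \<le> \<phi> t"
  shows "d \<ge> 0"
proof (rule ccontr)
  assume "\<not> d \<ge> 0"
  then obtain k where k: "k > 0" "\<And>h. h > 0 \<Longrightarrow> h < k \<Longrightarrow> \<phi> t < \<phi> (t - h)"
    using DERIV_neg_dec_left[OF d] by auto
  define h where "h = min e k / 2"
  have h: "0 < h" "h < e" "h < k" using e k by (auto simp: h_def)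
  show False using mx[of "t - h"] k(2)[of h] h by auto
qed

text \<open>A pointwise notion: the first space derivative is asked for only near \<open>x\<close>
  at the fixed time \<open>t\<close>, because the comparison functions below involve real powers
  that are smooth only on a moving half-line.\<close>

definition parabolic_derivs ::
  "(real \<Rightarrow> real \<Rightarrow> real) \<Rightarrow> real \<Rightarrow> real \<Rightarrow> real \<Rightarrow> real \<Rightarrow> bool" where
  "parabolic_derivs w t x wt wxx \<longleftrightarrow>
     ((\<lambda>s. w s x) has_real_derivative wt) (at t) \<and>
     (\<exists>wx e. e > 0 \<and> (\<forall>y. \<bar>y - x\<bar> < e \<longrightarrow> (w t has_real_derivative wx y) (at y)) \<and>
             (wx has_real_derivative wxx) (at x))"

lemma parabolic_derivs_diff:
  assumes "parabolic_derivs v t x vt vxx" "parabolic_derivs w t x wt wxx"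
  shows "parabolic_derivs (\<lambda>t x. v t x - w t x) t x (vt - wt) (vxx - wxx)"
proof -
  obtain vx e where v: "((\<lambda>s. v s x) has_real_derivative vt) (at t)" "e > 0"
     "\<And>y. \<bar>y - x\<bar> < e \<Longrightarrow> (v t has_real_derivative vx y) (at y)"
     "(vx has_real_derivative vxx) (at x)"
    using assms(1) by (auto simp: parabolic_derivs_def)
  obtain wx e' where w: "((\<lambda>s. w s x) has_real_derivative wt) (at t)" "e' > 0"
     "\<And>y. \<bar>y - x\<bar> < e' \<Longrightarrow> (w t has_real_derivative wx y) (at y)"
     "(wx has_real_derivative wxx) (at x)"
    using assms(2) by (auto simp: parabolic_derivs_def)
  show ?thesis unfolding parabolic_derivs_def
    using v w by (intro conjI exI[of _ "\<lambda>y. vx y - wx y"] exI[of _ "min e e'"]) (auto intro!: DERIV_diff)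
qed

lemma parabolic_derivs_tmult:
  assumes "parabolic_derivs w t x wt wxx" "(g has_real_derivative gt) (at t)"
  shows "parabolic_derivs (\<lambda>t x. g t * w t x) t x (gt * w t x + wt * g t) (g t * wxx)"
proof -
  obtain wx e' where w: "((\<lambda>s. w s x) has_real_derivative wt) (at t)" "e' > 0"
     "\<And>y. \<bar>y - x\<bar> < e' \<Longrightarrow> (w t has_real_derivative wx y) (at y)"
     "(wx has_real_derivative wxx) (at x)"
    using assms(1) by (auto simp: parabolic_derivs_def)
  show ?thesis unfolding parabolic_derivs_def
    using w assms(2)
    by (intro conjI exI[of _ "\<lambda>y. g t * wx y"] exI[of _ e'] DERIV_mult) (auto intro!: DERIV_cmult)
qed

lemma parabolic_derivs_cmult:
  assumes "parabolic_derivs w t x wt wxx"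
  shows "parabolic_derivs (\<lambda>t x. k * w t x) t x (k * wt) (k * wxx)"
  using parabolic_derivs_tmult[OF assms DERIV_const[of k]] by (simp add: mult.commute)

lemma parabolic_derivs_globalI:
  assumes "((\<lambda>s. w s x) has_real_derivative wt) (at t)"
    and "\<And>y. (w t has_real_derivative wx y) (at y)"
    and "(wx has_real_derivative wxx) (at x)"
  shows "parabolic_derivs w t x wt wxx"
  unfolding parabolic_derivs_def using assms by (auto intro!: exI[of _ wx] exI[of _ "1::real"])

text \<open>The differential inequality is required only where \<open>w > 0\<close>, and at such points only the part of a
  neighbourhood with times \<open>s \<le> t\<close> must lie in \<open>D\<close>: this excludes the parabolic boundary but
  not the final time.\<close>
lemma parabolic_max_principle:
  fixes w :: "real \<Rightarrow> real \<Rightarrow> real"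
  assumes clD: "closed D" and DT: "\<And>t x. (t, x) \<in> D \<Longrightarrow> T0 \<le> t \<and> t \<le> T1"
    and cont: "continuous_on D (\<lambda>(t, x). w t x)"
    and bdd: "\<And>t x. (t, x) \<in> D \<Longrightarrow> w t x \<le> N"
    and int: "\<And>t x. (t, x) \<in> D \<Longrightarrow> w t x > 0 \<Longrightarrow>
       (\<exists>U. open U \<and> (t, x) \<in> U \<and> (\<forall>s y. (s, y) \<in> U \<longrightarrow> s \<le> t \<longrightarrow> (s, y) \<in> D)) \<and>
       (\<exists>wt wxx. parabolic_derivs w t x wt wxx \<and> wt \<le> wxx + K * w t x)"
    and mem: "(t, x) \<in> D"
  shows "w t x \<le> 0"
proof (rule ccontr)
  assume "\<not> w t x \<le> 0"
  then have pos: "w t x > 0" by simp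
  \<comment> \<open>The strict inequality \<open>L > K\<close> lets the factor \<open>g\<close>
    absorb the zero-order term with something to spare, and \<open>L \<ge> 0\<close> keeps
    \<open>g \<le> 1\<close> on \<open>D\<close>, so that \<open>N\<close> still bounds
    \<open>g s * w s y\<close> up to sign.\<close>
  define L where "L = \<bar>K\<bar> + 1"
  define g where "g = (\<lambda>s. exp (- L * (s - T0)))"
  \<comment> \<open>This size makes the penalty at the given point at most half of
    \<open>g t * w t x\<close>, so the penalised function stays positive there.\<close>
  define \<eta> where "\<eta> = g t * w t x / 2 / (x\<^sup>2 + 2 * (t - T0) + 1)"
  have tT: "T0 \<le> t" "t \<le> T1" using DT[OF mem] by auto
  have gpos: "g s > 0" for s by (simp add: g_def)
  have den: "x\<^sup>2 + 2 * (t - T0) + 1 > 0" using tT by (smt (verit) zero_le_power2)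
  have \<eta>: "\<eta> > 0" unfolding \<eta>_def using pos gpos den by (intro divide_pos_pos mult_pos_pos) auto
  \<comment> \<open>The quadratic penalty solves the heat equation and forces the maximum to be attained.\<close>
  define q where "q = (\<lambda>s y :: real. \<eta> * (y\<^sup>2 + 2 * (s - T0)))"
  define \<phi> where "\<phi> = (\<lambda>s y. g s * w s y - q s y)"
  have "q t x \<le> \<eta> * (x\<^sup>2 + 2 * (t - T0) + 1)" using \<eta> by (simp add: q_def)
  also have "\<dots> = g t * w t x / 2" unfolding \<eta>_def
    by (rule nonzero_eq_divide_eq[THEN iffD1, OF _ refl]) (use den in simp)
  also have "\<dots> < g t * w t x" using pos gpos[of t] by simp
  finally have \<phi>pos: "\<phi> t x > 0" by (simp add: \<phi>_def)
  \<comment> \<open>For \<open>\<bar>y\<bar> > R\<close> the penalty exceeds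
    \<open>\<bar>N\<bar>\<close>, so the penalised function is nonpositive. Its maximum over the
    compact set \<open>C\<close> is therefore a maximum over all of \<open>D\<close>; the summand
    \<open>\<bar>x\<bar>\<close> puts the given point into \<open>C\<close>.\<close>
  define R where "R = \<bar>x\<bar> + sqrt (\<bar>N\<bar> / \<eta>)"
  define C where "C = D \<inter> ({T0..T1} \<times> {-R..R})"
  have "compact C" unfolding C_def using clD by (intro closed_Int_compact compact_Times) auto
  moreover have memC: "(t, x) \<in> C"
  proof -
    have "sqrt (\<bar>N\<bar> / \<eta>) \<ge> 0" using \<eta> by simp
    then have "x \<in> {-R..R}" unfolding R_def atLeastAtMost_iff by linarith
    then show ?thesis using mem tT by (simp add: C_def)
  qed
  moreover have "continuous_on C (\<lambda>(s, y). \<phi> s y)"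
  proof -
    have "continuous_on C (\<lambda>p. w (fst p) (snd p))"
      using continuous_on_subset[OF cont, of C] by (simp add: C_def case_prod_unfold)
    then show ?thesis unfolding \<phi>_def g_def q_def case_prod_unfold
      by (intro continuous_intros)
  qed
  ultimately obtain p where p: "p \<in> C" "\<And>z. z \<in> C \<Longrightarrow> (\<lambda>(s, y). \<phi> s y) z \<le> (\<lambda>(s, y). \<phi> s y) p"
    using continuous_attains_sup[of C "\<lambda>(s, y). \<phi> s y"] by blast
  obtain t' x' where p_eq: "p = (t', x')" by fastforce
  have D': "(t', x') \<in> D" and C': "T0 \<le> t'" "t' \<le> T1" using p(1) by (auto simp: C_def p_eq)
  have max: "\<phi> s y \<le> \<phi> t' x'" if "(s, y) \<in> D" for s y
  proof (cases "\<bar>y\<bar> \<le> R")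
    case True
    then show ?thesis using p(2)[of "(s, y)"] that DT[OF that] by (auto simp: p_eq C_def abs_le_iff)
  next
    case False
    then have "sqrt (\<bar>N\<bar> / \<eta>) \<le> \<bar>y\<bar>" by (auto simp: R_def)
    then have "\<bar>N\<bar> / \<eta> \<le> y\<^sup>2" by (metis real_sqrt_le_iff real_sqrt_abs)
    then have "\<bar>N\<bar> \<le> \<eta> * y\<^sup>2" using \<eta> by (simp add: field_simps)
    moreover have "g s * w s y \<le> \<bar>N\<bar>"
    proof -
      have "g s * w s y \<le> g s * \<bar>N\<bar>" using bdd[OF that] gpos[of s] by (intro mult_left_mono) auto
      also have "L * (s - T0) \<ge> 0" using DT[OF that] by (simp add: L_def)
      then have "g s * \<bar>N\<bar> \<le> 1 * \<bar>N\<bar>" by (intro mult_right_mono) (auto simp: g_def)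
      finally show ?thesis by simp
    qed
    moreover have "\<eta> * (2 * (s - T0)) \<ge> 0" using \<eta> DT[OF that] by auto
    ultimately have "\<phi> s y \<le> 0" by (simp add: \<phi>_def q_def distrib_left)
    also have "\<dots> \<le> \<phi> t' x'" using \<phi>pos p(2)[OF memC] by (simp add: p_eq)
    finally show ?thesis .
  qed
  have \<phi>': "\<phi> t' x' > 0" using max[OF mem] \<phi>pos by simp
  moreover have "q t' x' \<ge> 0" using \<eta> C' by (auto simp: q_def)
  ultimately have "g t' * w t' x' > 0" by (simp add: \<phi>_def)
  then have w': "w t' x' > 0" using gpos[of t'] by (simp add: zero_less_mult_iff)
  obtain U where U: "open U" "(t', x') \<in> U" "\<And>s y. (s, y) \<in> U \<Longrightarrow> s \<le> t' \<Longrightarrow> (s, y) \<in> D"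
    using int[OF D' w'] by blast
  obtain wt wxx where pw: "parabolic_derivs w t' x' wt wxx" "wt \<le> wxx + K * w t' x'"
    using int[OF D' w'] by blast
  have pq: "parabolic_derivs q t' x' (2 * \<eta>) (2 * \<eta>)"
    unfolding q_def by (rule parabolic_derivs_globalI[where wx = "\<lambda>y. 2 * \<eta> * y"])
      (auto intro!: derivative_eq_intros)
  have gd: "(g has_real_derivative (- L * g t')) (at t')"
    unfolding g_def by (auto intro!: derivative_eq_intros)
  have "parabolic_derivs \<phi> t' x' (- L * g t' * w t' x' + wt * g t' - 2 * \<eta>) (g t' * wxx - 2 * \<eta>)"
    unfolding \<phi>_def by (rule parabolic_derivs_diff[OF parabolic_derivs_tmult[OF pw(1) gd] pq])
  then obtain \<phi>1 e where e: "e > 0"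
      and dt: "((\<lambda>s. \<phi> s x') has_real_derivative - L * g t' * w t' x' + wt * g t' - 2 * \<eta>) (at t')"
      and d1: "\<And>y. \<bar>y - x'\<bar> < e \<Longrightarrow> (\<phi> t' has_real_derivative \<phi>1 y) (at y)"
      and d2: "(\<phi>1 has_real_derivative g t' * wxx - 2 * \<eta>) (at x')"
    by (auto simp: parabolic_derivs_def)
  obtain A B where AB: "open A" "open B" "t' \<in> A" "x' \<in> B" "A \<times> B \<subseteq> U"
    using open_prod_elim[OF U(1,2)] mem_Sigma_iff by metis
  obtain e1 where e1: "e1 > 0" "\<And>s. \<bar>s - t'\<bar> < e1 \<Longrightarrow> s \<in> A"
    using AB(1,3) by (metis open_real)
  obtain e2 where e2: "e2 > 0" "\<And>s. \<bar>s - x'\<bar> < e2 \<Longrightarrow> s \<in> B"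
    using AB(2,4) by (metis open_real)
  have in_D: "(s, y) \<in> D" if "\<bar>s - t'\<bar> < e1" "\<bar>y - x'\<bar> < e2" "s \<le> t'" for s y
    using that U(3) AB(5) e1(2) e2(2) by blast
  \<comment> \<open>At the maximum the time derivative is nonnegative and the second space
    derivative nonpositive. The penalty contributes the same \<open>2 * \<eta>\<close> to both and
    cancels, so the differential inequality would give L g w <= K g w with g w > 0.\<close>
  have "- L * g t' * w t' x' + wt * g t' - 2 * \<eta> \<ge> 0"
    by (rule deriv_nonneg_at_left_max[OF e1(1) dt])
      (use e1(1) e2(1) in \<open>auto intro!: max in_D\<close>)
  moreover have "g t' * wxx - 2 * \<eta> \<le> 0"
    by (rule second_deriv_nonpos_at_max[where e = "min e e2", OF _ d1 d2])
      (use e e1(1) e2(1) in \<open>auto intro!: max in_D\<close>)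
  moreover have "g t' * (wt - wxx - K * w t' x') \<le> 0"
    using pw(2) gpos[of t'] by (intro mult_nonneg_nonpos) auto
  moreover have "K * (g t' * w t' x') < L * (g t' * w t' x')"
    using gpos[of t'] w' by (intro mult_strict_right_mono) (auto simp: L_def)
  ultimately show False by (simp add: algebra_simps)
qed


section \<open>Basic properties of solutions of the Cauchy problem\<close>

lemma rd_solution_parabolic:
  assumes "rd_solution f u0 u" "t > 0"
  obtains ut uxx where "parabolic_derivs u t x ut uxx" "ut = uxx + f (u t x)"
proof -
  obtain ut ux uxx where d: "\<forall>t>0. \<forall>x.
           ((\<lambda>s. u s x) has_real_derivative ut t x) (at t) \<and>
           ((\<lambda>y. u t y) has_real_derivative ux t x) (at x) \<and>
           ((\<lambda>y. ux t y) has_real_derivative uxx t x) (at x) \<and>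
           ut t x = uxx t x + f (u t x)"
    using assms(1) unfolding rd_solution_def by blast
  from d assms(2) have "((\<lambda>s. u s x) has_real_derivative ut t x) (at t)"
    "\<And>y. (u t has_real_derivative ux t y) (at y)" "(ux t has_real_derivative uxx t x) (at x)"
    by blast+
  then have "parabolic_derivs u t x (ut t x) (uxx t x)" by (rule parabolic_derivs_globalI)
  with that d assms(2) show thesis by blast
qed

lemma rd_solution_continuous:
  assumes "rd_solution f u0 u" "\<And>p. p \<in> D \<Longrightarrow> fst p \<ge> 0"
  shows "continuous_on D (\<lambda>p. u (fst p) (snd p))"
proof -
  have "continuous_on ({0..} \<times> UNIV) (\<lambda>p. u (fst p) (snd p))"
    using assms(1) by (simp add: rd_solution_def case_prod_unfold)
  then show ?thesis by (rule continuous_on_subset) (use assms(2) in force)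
qed

text \<open>The maximum principle is applied to -u and to u - 1. Its differential inequality is
  required only where these are positive, that is where u lies outside [0,1]; there the linear
  extension of \<open>f\<close> is exactly a zero-order term with coefficient \<open>k0\<close> or
  \<open>k1\<close>.\<close>

lemma rd_solution_range:
  assumes sol: "rd_solution f u0 u" and u0: "\<And>x. 0 \<le> u0 x \<and> u0 x \<le> 1"
    and left: "\<And>s. s < 0 \<Longrightarrow> f s = k0 * s" and right: "\<And>s. s > 1 \<Longrightarrow> f s = k1 * (s - 1)"
    and "t \<ge> 0"
  shows "0 \<le> u t x" "u t x \<le> 1"
proof -
  have cont': "continuous_on ({0..t} \<times> UNIV) (\<lambda>p. u (fst p) (snd p))"
    by (rule rd_solution_continuous[OF sol]) auto
  have "bounded ((\<lambda>(t,x). u t x) ` ({0..} \<times> UNIV))" using sol by (simp add: rd_solution_def)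
  then obtain N where N: "\<And>s y. s \<ge> 0 \<Longrightarrow> \<bar>u s y\<bar> \<le> N" by (force simp: bounded_iff)
  have ini: "u 0 y = u0 y" for y using sol by (simp add: rd_solution_def)
  have nbhd: "\<exists>U. open U \<and> (s, y) \<in> U \<and> (\<forall>s' y'. (s', y') \<in> U \<longrightarrow> s' \<le> s \<longrightarrow> (s', y') \<in> {0..t} \<times> UNIV)"
    if "(s, y) \<in> {0..t} \<times> UNIV" "s \<noteq> 0" for s and y :: real
    by (rule exI[of _ "{0<..} \<times> UNIV"]) (use that in \<open>auto intro!: open_Times\<close>)
  have const: "parabolic_derivs (\<lambda>_ _. k) s y 0 0" for k s y
    by (rule parabolic_derivs_globalI[where wx = "\<lambda>_. 0"]) auto
  have "(\<lambda>s y. 0 - u s y) t x \<le> 0"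
  proof (rule parabolic_max_principle[where w = "\<lambda>s y. 0 - u s y" and t = t and x = x and D = "{0..t} \<times> UNIV" and ?T0.0 = 0 and ?T1.0 = t and N = N and K = k0])
    fix s y assume D: "(s, y) \<in> {0..t} \<times> (UNIV :: real set)" and pos: "0 < 0 - u s y"
    have "s \<noteq> 0" using pos u0[of y] ini[of y] by auto
    then obtain ut uxx where d: "parabolic_derivs u s y ut uxx" "ut = uxx + f (u s y)"
      using rd_solution_parabolic[OF sol, of s y] D by auto
    show "(\<exists>U. open U \<and> (s, y) \<in> U \<and> (\<forall>s' y'. (s', y') \<in> U \<longrightarrow> s' \<le> s \<longrightarrow> (s', y') \<in> {0..t} \<times> UNIV)) \<and>
       (\<exists>wt wxx. parabolic_derivs (\<lambda>s y. 0 - u s y) s y wt wxx \<and> wt \<le> wxx + k0 * (0 - u s y))"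
      using nbhd[OF D \<open>s \<noteq> 0\<close>] parabolic_derivs_diff[OF const[of 0 s y] d(1)] left[of "u s y"] pos d(2)
      by (intro conjI exI[of _ "0 - ut"] exI[of _ "0 - uxx"]) auto
  qed (use N \<open>t \<ge> 0\<close> cont' in \<open>auto intro!: closed_Times continuous_intros simp: case_prod_unfold abs_le_iff\<close>)
  then show "0 \<le> u t x" by simp
  have "(\<lambda>s y. u s y - 1) t x \<le> 0"
  proof (rule parabolic_max_principle[where w = "\<lambda>s y. u s y - 1" and t = t and x = x and D = "{0..t} \<times> UNIV" and ?T0.0 = 0 and ?T1.0 = t and N = N and K = k1])
    fix s y assume D: "(s, y) \<in> {0..t} \<times> (UNIV :: real set)" and pos: "0 < u s y - 1"
    have "s \<noteq> 0" using pos u0[of y] ini[of y] by auto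
    then obtain ut uxx where d: "parabolic_derivs u s y ut uxx" "ut = uxx + f (u s y)"
      using rd_solution_parabolic[OF sol, of s y] D by auto
    show "(\<exists>U. open U \<and> (s, y) \<in> U \<and> (\<forall>s' y'. (s', y') \<in> U \<longrightarrow> s' \<le> s \<longrightarrow> (s', y') \<in> {0..t} \<times> UNIV)) \<and>
       (\<exists>wt wxx. parabolic_derivs (\<lambda>s y. u s y - 1) s y wt wxx \<and> wt \<le> wxx + k1 * (u s y - 1))"
      using nbhd[OF D \<open>s \<noteq> 0\<close>] parabolic_derivs_diff[OF d(1) const[of 1 s y]] right[of "u s y"] pos d(2)
      by (intro conjI exI[of _ "ut - 0"] exI[of _ "uxx - 0"]) auto
  next
    fix s y assume "(s, y) \<in> {0..t} \<times> (UNIV :: real set)"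
    then show "u s y - 1 \<le> N" using N[of s y] by auto
  qed (use \<open>t \<ge> 0\<close> cont' in \<open>auto intro!: closed_Times continuous_intros simp: case_prod_unfold\<close>)
  then show "u t x \<le> 1" by simp
qed

section \<open>Tail profiles for the linearised equation\<close>

text \<open>The initial tail x^beta exp(-gamma x), with its exponential factor carried at speed
  \<open>c\<close> and its power factor at speed \<open>b\<close>. The speed \<open>c\<close> is a
  parameter separate from \<open>\<gamma>\<close>, so that powers of a profile are again profiles
  with the same speeds.\<close>

definition tail_profile :: "real \<Rightarrow> real \<Rightarrow> real \<Rightarrow> real \<Rightarrow> real \<Rightarrow> real \<Rightarrow> real" where
  "tail_profile c b \<gamma> \<beta> t x = (x - b * t) powr \<beta> * exp (- \<gamma> * (x - c * t))"

lemma tail_profile_derivs: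
  fixes x b t c \<gamma> \<beta> :: real
  assumes s: "x - b * t > 0"
  defines "W \<equiv> tail_profile c b \<gamma> \<beta> t x"
  shows "parabolic_derivs (tail_profile c b \<gamma> \<beta>) t x
    (W * (\<gamma> * c - b * \<beta> / (x - b * t)))
    (W * ((\<beta> / (x - b * t) - \<gamma>)\<^sup>2 - \<beta> / (x - b * t)\<^sup>2))"
proof -
  have dt: "((\<lambda>s. tail_profile c b \<gamma> \<beta> s x) has_real_derivative
      W * (\<gamma> * c - b * \<beta> / (x - b * t))) (at t)"
    unfolding tail_profile_def W_def using s
    by (auto intro!: derivative_eq_intros simp: field_simps powr_diff)
  have dx: "(tail_profile c b \<gamma> \<beta> t has_real_derivative
      tail_profile c b \<gamma> \<beta> t y * (\<beta> / (y - b * t) - \<gamma>)) (at y)" if "y - b * t > 0" for y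
    unfolding tail_profile_def using that
    by (auto intro!: derivative_eq_intros simp: field_simps powr_diff)
  have "((\<lambda>y. tail_profile c b \<gamma> \<beta> t y * (\<beta> / (y - b * t) - \<gamma>)) has_real_derivative
      W * (\<beta> / (x - b * t) - \<gamma>) * (\<beta> / (x - b * t) - \<gamma>) + (- (\<beta> / (x - b * t)\<^sup>2)) * W) (at x)"
    unfolding W_def using s
    by (intro DERIV_mult dx) (auto intro!: derivative_eq_intros simp: field_simps power2_eq_square)
  moreover have "W * p * p + (- q) * W = W * (p\<^sup>2 - q)" for p q
    by (simp add: algebra_simps power2_eq_square)
  ultimately have dxx: "((\<lambda>y. tail_profile c b \<gamma> \<beta> t y * (\<beta> / (y - b * t) - \<gamma>)) has_real_derivative
      W * ((\<beta> / (x - b * t) - \<gamma>)\<^sup>2 - \<beta> / (x - b * t)\<^sup>2)) (at x)"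
    by metis
  \<comment> \<open>The radius \<open>x - b * t\<close> keeps the neighbourhood inside the half-line
    on which the power is differentiable.\<close>
  show ?thesis unfolding parabolic_derivs_def
    by (intro conjI dt exI[of _ "\<lambda>y. tail_profile c b \<gamma> \<beta> t y * (\<beta> / (y - b * t) - \<gamma>)"]
          exI[of _ "x - b * t"] dxx)
       (use s in \<open>auto intro!: dx simp: abs_less_iff\<close>)
qed

text \<open>With \<open>s\<close> the distance x - b t, this is the time derivative split into
  diffusion, a linear reaction with rate gamma c - gamma^2, and a remainder. For large
  \<open>s\<close> the sign of the remainder is that of (2 gamma - b) beta whenever this is nonzero,
  which is how the choice of \<open>b\<close> decides between super- and subsolutions.\<close>

lemma tail_profile_residual:
  fixes s :: real
  assumes "s > 0"
  shows "W * (\<gamma> * c - b * \<beta> / s) = W * ((\<beta> / s - \<gamma>)\<^sup>2 - \<beta> / s\<^sup>2) + (\<gamma> * c - \<gamma>\<^sup>2) * W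
     + W * (((2 * \<gamma> - b) * \<beta> * s - \<beta> * (\<beta> - 1)) / s\<^sup>2)"
  using assms by (simp add: field_simps power2_eq_square)

text \<open>Lets the correction Y^(1+theta) of the lower barrier be differentiated as a profile with
  parameters multiplied by 1 + theta.\<close>

lemma tail_profile_powr:
  assumes "x - b * t > 0"
  shows "tail_profile c b (\<gamma> * p) (\<beta> * p) t x = tail_profile c b \<gamma> \<beta> t x powr p"
  using assms by (simp add: tail_profile_def powr_mult powr_powr exp_powr_real mult_ac)

lemma continuous_on_tail_profile:
  assumes "\<And>p. p \<in> D \<Longrightarrow> snd p - b * fst p > 0"
  shows "continuous_on D (\<lambda>p. tail_profile c b \<gamma> \<beta> (fst p) (snd p))"
  unfolding tail_profile_def using assms by (intro continuous_intros) force

section \<open>Comparison with tail profiles on a moving half-line\<close>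

lemma half_plane_interior:
  fixes s0 b t :: real
  assumes "0 < s" "s \<le> t" "s0 < y - b * s"
  shows "\<exists>U. open U \<and> (s, y) \<in> U \<and>
    (\<forall>s' y'. (s', y') \<in> U \<longrightarrow> s' \<le> s \<longrightarrow> (s', y') \<in> {(s, y). 0 \<le> s \<and> s \<le> t \<and> s0 \<le> y - b * s})"
proof -
  let ?U = "{p :: real \<times> real. 0 < fst p} \<inter> {p. s0 < snd p - b * fst p}"
  have "open ?U" by (intro open_Int open_Collect_less continuous_intros)
  then show ?thesis using assms by (intro exI[of _ ?U]) auto
qed

lemma closed_half_plane:
  "closed {(s, y). 0 \<le> s \<and> s \<le> t \<and> s0 \<le> y - b * (s :: real)}"
proof -
  have "{(s, y). 0 \<le> s \<and> s \<le> t \<and> s0 \<le> y - b * s} =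
    {p :: real \<times> real. 0 \<le> fst p} \<inter> {p. fst p \<le> t} \<inter> {p. s0 \<le> snd p - b * fst p}" by auto
  moreover have "closed \<dots>" by (intro closed_Int closed_Collect_le continuous_intros)
  ultimately show ?thesis by simp
qed

text \<open>By \<open>super\<close> the remainder is nonnegative, so C Y is a supersolution of the
  equation with reaction r w, of which u is a subsolution by \<open>f\<close>. The two conditions on
  \<open>C\<close> and \<open>ini\<close> give the order on the lateral boundary, where C Y >= 1 >=
  u, and at time 0.\<close>

lemma upper_tail_bound:
  assumes sol: "rd_solution f u0 u"
    and range: "\<And>t x. t \<ge> 0 \<Longrightarrow> 0 \<le> u t x \<and> u t x \<le> 1"
    and f: "\<And>s. 0 \<le> s \<Longrightarrow> s \<le> 1 \<Longrightarrow> f s \<le> r * s"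
    and r: "lam * c - lam\<^sup>2 = r" and lam: "lam > 0" and b: "b \<le> c" and s0: "s0 > 0"
    and super: "\<And>s. s \<ge> s0 \<Longrightarrow> \<nu> * (\<nu> - 1) \<le> (2 * lam - b) * \<nu> * s"
    and C: "C \<ge> 0" "1 \<le> C * (s0 powr \<nu> * exp (- lam * s0))"
    and ini: "\<And>x. x \<ge> s0 \<Longrightarrow> u0 x \<le> C * (x powr \<nu> * exp (- lam * x))"
    and t: "t \<ge> 0" and x: "x - b * t \<ge> s0"
  shows "u t x \<le> C * tail_profile c b lam \<nu> t x"
proof -
  let ?Y = "tail_profile c b lam \<nu>"
  let ?D = "{(s, y). 0 \<le> s \<and> s \<le> t \<and> s0 \<le> y - b * s}"
  have Y: "?Y s y \<ge> 0" for s y by (simp add: tail_profile_def)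
  have cont': "continuous_on ?D (\<lambda>p. u (fst p) (snd p))"
    by (rule rd_solution_continuous[OF sol]) auto
  have "(\<lambda>s y. u s y - C * ?Y s y) t x \<le> 0"
  proof (rule parabolic_max_principle[where w = "\<lambda>s y. u s y - C * ?Y s y" and t = t and x = x and D = ?D and ?T0.0 = 0 and ?T1.0 = t and N = 1 and K = r])
    show "closed ?D" by (rule closed_half_plane)
    show "continuous_on ?D (\<lambda>(t, x). u t x - C * ?Y t x)"
      unfolding case_prod_unfold using cont' s0
      by (intro continuous_intros continuous_on_tail_profile) (auto simp: case_prod_unfold)
  next
    fix s y assume "(s, y) \<in> ?D"
    then show "u s y - C * ?Y s y \<le> 1" using range[of s y] mult_nonneg_nonneg[OF C(1) Y[of s y]] by auto
  next
    fix s y assume D: "(s, y) \<in> ?D" and pos: "0 < u s y - C * ?Y s y"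
    let ?s = "y - b * s"
    have D': "0 \<le> s" "s \<le> t" "s0 \<le> ?s" using D by auto
    have "s \<noteq> 0"
    proof
      assume "s = 0"
      moreover have "u 0 y = u0 y" using sol by (simp add: rd_solution_def)
      ultimately show False using ini[of y] pos D' by (simp add: tail_profile_def)
    qed
    then have s: "0 < s" using D' by simp
    have "s0 \<noteq> ?s"
    proof
      assume eq: "s0 = ?s"
      \<comment> \<open>Since \<open>b \<le> c\<close>, the point lies at most \<open>s0\<close>
        ahead of c s, so the profile on the lateral boundary is never below its value at time
        0.\<close>
      have "lam * (y - c * s) \<le> lam * s0" using eq b s lam by (intro mult_left_mono) auto
      then have "s0 powr \<nu> * exp (- lam * s0) \<le> ?Y s y"
        unfolding tail_profile_def eq[symmetric] by (intro mult_left_mono) auto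
      then have "1 \<le> C * ?Y s y" using C mult_left_mono by (meson order_trans)
      then show False using pos range[of s y] s by auto
    qed
    then have ss: "s0 < ?s" using D' by simp
    then have s_pos: "?s > 0" using s0 by simp
    obtain ut uxx where d: "parabolic_derivs u s y ut uxx" "ut = uxx + f (u s y)"
      using rd_solution_parabolic[OF sol s] by blast
    let ?Yt = "?Y s y * (lam * c - b * \<nu> / ?s)"
    let ?Yxx = "?Y s y * ((\<nu> / ?s - lam)\<^sup>2 - \<nu> / ?s\<^sup>2)"
    have "((2 * lam - b) * \<nu> * ?s - \<nu> * (\<nu> - 1)) / ?s\<^sup>2 \<ge> 0"
      using super[of ?s] ss by (intro divide_nonneg_nonneg) auto
    from mult_nonneg_nonneg[OF Y[of s y] this] have "?Yxx + r * ?Y s y \<le> ?Yt"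
      unfolding tail_profile_residual[OF s_pos, of "?Y s y" lam c b \<nu>] r by linarith
    then have "C * (?Yxx + r * ?Y s y) \<le> C * ?Yt" using C(1) by (rule mult_left_mono)
    moreover have "f (u s y) \<le> r * u s y" using f range[of s y] s by auto
    ultimately have ineq: "ut - C * ?Yt \<le> (uxx - C * ?Yxx) + r * (u s y - C * ?Y s y)"
      using d(2) by (simp add: algebra_simps)
    show "(\<exists>U. open U \<and> (s, y) \<in> U \<and> (\<forall>s' y'. (s', y') \<in> U \<longrightarrow> s' \<le> s \<longrightarrow> (s', y') \<in> ?D)) \<and>
       (\<exists>wt wxx. parabolic_derivs (\<lambda>s y. u s y - C * ?Y s y) s y wt wxx \<and>
           wt \<le> wxx + r * (u s y - C * ?Y s y))"
      using half_plane_interior[OF s D'(2) ss]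
        parabolic_derivs_diff[OF d(1) parabolic_derivs_cmult[OF tail_profile_derivs[OF s_pos], where k = C]] ineq
      by blast
  qed (use t x in auto)
  then show ?thesis by simp
qed

text \<open>For the barrier p = a Y - A W with W = Y^(1+theta), the term a Y is a subsolution of the
  linear equation, while W is a supersolution with surplus kappa W. The surplus pays for the
  quadratic loss: where p > u one has u <= a Y and Y <= 1, so M u^2 <= M a^2 Y^2 <= A kappa W, the
  last step by theta <= 1.\<close>

lemma lower_tail_bound:
  assumes sol: "rd_solution f u0 u"
    and range: "\<And>t x. t \<ge> 0 \<Longrightarrow> 0 \<le> u t x \<and> u t x \<le> 1"
    and f: "\<And>s. 0 \<le> s \<Longrightarrow> s \<le> 1 \<Longrightarrow> r * s - M * s\<^sup>2 \<le> f s" and M: "M \<ge> 0"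
    and r: "lam * c - lam\<^sup>2 = r" and lam: "lam > 0" and b: "b \<le> c" and s0: "s0 > 0"
    and sub: "\<And>s. s \<ge> s0 \<Longrightarrow> (2 * lam - b) * \<nu> * s \<le> \<nu> * (\<nu> - 1)"
    and \<theta>: "0 < \<theta>" "\<theta> \<le> 1" and \<gamma>: "\<gamma> = lam * (1 + \<theta>)" and \<beta>: "\<beta> = \<nu> * (1 + \<theta>)"
    and super: "\<And>s. s \<ge> s0 \<Longrightarrow>
        \<kappa> \<le> \<gamma> * c - \<gamma>\<^sup>2 - r + ((2 * \<gamma> - b) * \<beta> * s - \<beta> * (\<beta> - 1)) / s\<^sup>2"
    and a: "0 < a" "a \<le> A" "M * a\<^sup>2 \<le> A * \<kappa>" "a \<le> A * (s0 powr \<nu> * exp (- lam * s0)) powr \<theta>"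
    and ini: "\<And>x. x \<ge> s0 \<Longrightarrow> a * (x powr \<nu> * exp (- lam * x)) \<le> u0 x"
    and t: "t \<ge> 0" and x: "x - b * t \<ge> s0"
  shows "a * tail_profile c b lam \<nu> t x - A * tail_profile c b lam \<nu> t x powr (1 + \<theta>) \<le> u t x"
proof -
  let ?Y = "tail_profile c b lam \<nu>"
  let ?W = "tail_profile c b \<gamma> \<beta>"
  let ?p = "\<lambda>s y. a * ?Y s y - A * ?W s y"
  let ?D = "{(s, y). 0 \<le> s \<and> s \<le> t \<and> s0 \<le> y - b * s}"
  have Y: "?Y s y \<ge> 0" for s y by (simp add: tail_profile_def)
  have W: "?W s y \<ge> 0" for s y by (simp add: tail_profile_def)
  have W_eq: "?W s y = ?Y s y powr (1 + \<theta>)" if "y - b * s > 0" for s y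
    unfolding \<gamma> \<beta> by (rule tail_profile_powr[OF that])
  have small: "?Y s y \<le> 1" if "?p s y > 0" "y - b * s > 0" for s y
  proof (rule ccontr)
    assume "\<not> ?Y s y \<le> 1"
    then have "?Y s y powr 1 \<le> ?Y s y powr (1 + \<theta>)" using \<theta> by (intro powr_mono) auto
    then have "?Y s y \<le> ?W s y" using W_eq[OF that(2)] Y[of s y] by simp
    then have "a * ?Y s y \<le> A * ?W s y" using a(1,2) Y[of s y] by (intro mult_mono) auto
    then show False using that(1) by simp
  qed
  have cont': "continuous_on ?D (\<lambda>p. u (fst p) (snd p))"
    by (rule rd_solution_continuous[OF sol]) auto
  have "(\<lambda>s y. ?p s y - u s y) t x \<le> 0"
  proof (rule parabolic_max_principle[where w = "\<lambda>s y. ?p s y - u s y" and t = t and x = x and D = ?D and ?T0.0 = 0 and ?T1.0 = t and N = a and K = r])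
    show "closed ?D" by (rule closed_half_plane)
    show "continuous_on ?D (\<lambda>(t, x). ?p t x - u t x)"
      unfolding case_prod_unfold using cont' s0
      by (intro continuous_intros continuous_on_tail_profile) (auto simp: case_prod_unfold)
  next
    fix s y assume D: "(s, y) \<in> ?D"
    then have u: "u s y \<ge> 0" and s_pos: "y - b * s > 0" using range[of s y] s0 by auto
    show "?p s y - u s y \<le> a"
    proof (cases "?p s y > 0")
      case True
      have "a * ?Y s y \<le> a * 1" using a(1) small[OF True s_pos] by (intro mult_left_mono) auto
      moreover have "A * ?W s y \<ge> 0" using a W[of s y] by auto
      ultimately show ?thesis using u by linarith
    qed (use u a in auto)
  next
    fix s y assume D: "(s, y) \<in> ?D" and pos: "0 < ?p s y - u s y"
    let ?s = "y - b * s"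
    have D': "0 \<le> s" "s \<le> t" "s0 \<le> ?s" using D by auto
    have u: "0 \<le> u s y" "u s y \<le> 1" using range[of s y] D' by auto
    then have p_pos: "?p s y > 0" using pos by simp
    have s_pos: "?s > 0" using D' s0 by simp
    have AW: "A * ?W s y \<ge> 0" using a W[of s y] by auto
    have "s \<noteq> 0"
    proof
      assume "s = 0"
      moreover have "u 0 y = u0 y" using sol by (simp add: rd_solution_def)
      ultimately show False using ini[of y] pos D' AW by (simp add: tail_profile_def)
    qed
    then have s: "0 < s" using D' by simp
    \<comment> \<open>On the lateral boundary the last condition on \<open>A\<close> gives a <= A
      Y^theta, so the barrier is nonpositive there.\<close>
    have "s0 \<noteq> ?s"
    proof
      assume eq: "s0 = ?s"
      have "lam * (y - c * s) \<le> lam * s0" using eq b s lam by (intro mult_left_mono) auto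
      then have le: "s0 powr \<nu> * exp (- lam * s0) \<le> ?Y s y"
        unfolding tail_profile_def eq[symmetric] by (intro mult_left_mono) auto
      have "a \<le> A * (s0 powr \<nu> * exp (- lam * s0)) powr \<theta>" by (rule a(4))
      also have "\<dots> \<le> A * ?Y s y powr \<theta>"
        using le a \<theta> s0 by (intro mult_left_mono powr_mono2) auto
      finally have "a * ?Y s y \<le> A * ?Y s y powr \<theta> * ?Y s y" using Y by (rule mult_right_mono)
      also have "\<dots> = A * ?W s y" using W_eq[OF s_pos] Y[of s y] by (simp add: powr_add)
      finally show False using p_pos by simp
    qed
    then have ss: "s0 < ?s" using D' by simp
    obtain ut uxx where d: "parabolic_derivs u s y ut uxx" "ut = uxx + f (u s y)"
      using rd_solution_parabolic[OF sol s] by blast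
    let ?Yt = "?Y s y * (lam * c - b * \<nu> / ?s)"
    let ?Yxx = "?Y s y * ((\<nu> / ?s - lam)\<^sup>2 - \<nu> / ?s\<^sup>2)"
    let ?Wt = "?W s y * (\<gamma> * c - b * \<beta> / ?s)"
    let ?Wxx = "?W s y * ((\<beta> / ?s - \<gamma>)\<^sup>2 - \<beta> / ?s\<^sup>2)"
    have "((2 * lam - b) * \<nu> * ?s - \<nu> * (\<nu> - 1)) / ?s\<^sup>2 \<le> 0"
      using sub[of ?s] ss by (intro divide_nonpos_nonneg) auto
    from mult_nonneg_nonpos[OF Y[of s y] this] have "?Yt \<le> ?Yxx + r * ?Y s y"
      unfolding tail_profile_residual[OF s_pos, of "?Y s y" lam c b \<nu>] r by linarith
    then have 1: "a * ?Yt \<le> a * (?Yxx + r * ?Y s y)" using a(1) by (intro mult_left_mono) auto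
    have "?W s y * \<kappa> \<le> ?W s y * (\<gamma> * c - \<gamma>\<^sup>2 - r + ((2 * \<gamma> - b) * \<beta> * ?s - \<beta> * (\<beta> - 1)) / ?s\<^sup>2)"
      using super[of ?s] ss W by (intro mult_left_mono) auto
    then have "?Wxx + r * ?W s y + \<kappa> * ?W s y \<le> ?Wt"
      unfolding tail_profile_residual[OF s_pos, of "?W s y" \<gamma> c b \<beta>] by (simp only: algebra_simps)
    then have 2: "A * (?Wxx + r * ?W s y + \<kappa> * ?W s y) \<le> A * ?Wt" using a by (intro mult_left_mono) auto
    have "u s y \<le> a * ?Y s y" using pos AW by simp
    then have "(u s y)\<^sup>2 \<le> (a * ?Y s y)\<^sup>2" using u by (intro power_mono) auto
    from mult_left_mono[OF this M] have "M * (u s y)\<^sup>2 \<le> M * a\<^sup>2 * (?Y s y)\<^sup>2"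
      by (simp add: power_mult_distrib mult.assoc)
    also have "\<dots> \<le> A * \<kappa> * (?Y s y)\<^sup>2" using a by (intro mult_right_mono) auto
    also have "\<dots> \<le> A * \<kappa> * ?W s y"
    proof (rule mult_left_mono)
      have "?Y s y powr 2 \<le> ?Y s y powr (1 + \<theta>)"
        using small[OF p_pos s_pos] Y[of s y] \<theta> by (intro powr_mono') auto
      then show "(?Y s y)\<^sup>2 \<le> ?W s y" using W_eq[OF s_pos] Y[of s y] by simp
      show "0 \<le> A * \<kappa>" using a(3) M by (meson mult_nonneg_nonneg order_trans zero_le_power2)
    qed
    finally have 3: "M * (u s y)\<^sup>2 \<le> A * \<kappa> * ?W s y" .
    have "r * u s y - M * (u s y)\<^sup>2 \<le> f (u s y)" using f u by auto
    with 1 2 3 have ineq: "(a * ?Yt - A * ?Wt) - ut \<le> ((a * ?Yxx - A * ?Wxx) - uxx) + r * (?p s y - u s y)"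
      using d(2) by (simp add: algebra_simps)
    show "(\<exists>U. open U \<and> (s, y) \<in> U \<and> (\<forall>s' y'. (s', y') \<in> U \<longrightarrow> s' \<le> s \<longrightarrow> (s', y') \<in> ?D)) \<and>
       (\<exists>wt wxx. parabolic_derivs (\<lambda>s y. ?p s y - u s y) s y wt wxx \<and>
           wt \<le> wxx + r * (?p s y - u s y))"
      using half_plane_interior[OF s D'(2) ss] ineq
        parabolic_derivs_diff[OF parabolic_derivs_diff[OF
          parabolic_derivs_cmult[OF tail_profile_derivs[OF s_pos], where k = a]
          parabolic_derivs_cmult[OF tail_profile_derivs[OF s_pos], where k = A]] d(1)]
      by blast
  qed (use t x in auto)
  moreover have "x - b * t > 0" using x s0 by simp
  ultimately show ?thesis using W_eq by simp
qed


section \<open>Lower bounds behind a moving point and local growth\<close>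

text \<open>The left-hand side of the conclusion is a travelling wave of the heat equation with
  speed \<open>\<sigma>\<close>. It vanishes on the line starting at \<open>X T\<close> and never
  exceeds \<open>\<delta>\<close>, while u is a supersolution of the heat equation because
  \<open>f\<close> is nonnegative. The comparison takes place between that line and the curve
  \<open>X\<close>.\<close>

lemma spreading_behind_front:
  fixes X :: "real \<Rightarrow> real"
  assumes sol: "rd_solution f u0 u"
    and range: "\<And>t x. t \<ge> 0 \<Longrightarrow> 0 \<le> u t x \<and> u t x \<le> 1"
    and f: "\<And>s. 0 \<le> s \<Longrightarrow> s \<le> 1 \<Longrightarrow> 0 \<le> f s"
    and X: "continuous_on UNIV X" and T: "T > 0" and \<delta>: "\<delta> \<ge> 0"
    and front: "\<And>t. t \<ge> T \<Longrightarrow> \<delta> \<le> u t (X t)"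
    and t: "t \<ge> T" and x: "X T + \<sigma> * (t - T) \<le> x" "x \<le> X t"
  shows "\<delta> * (1 - exp (- \<sigma> * (x - X T - \<sigma> * (t - T)))) \<le> u t x"
proof -
  let ?\<psi> = "\<lambda>s y. \<delta> * (1 - exp (- \<sigma> * (y - X T - \<sigma> * (s - T))))"
  let ?D = "{(s, y). T \<le> s \<and> s \<le> t \<and> X T + \<sigma> * (s - T) \<le> y \<and> y \<le> X s}"
  have cX: "continuous_on UNIV (\<lambda>p :: real \<times> real. X (fst p))"
    using continuous_on_compose2[OF X, of UNIV fst] by (simp add: continuous_on_fst)
  have cont: "continuous_on ?D (\<lambda>p. u (fst p) (snd p))"
    by (rule rd_solution_continuous[OF sol]) (use T in auto)
  have \<psi>_le: "?\<psi> s y \<le> \<delta>" for s y using \<delta> by (simp add: algebra_simps)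
  have "(\<lambda>s y. ?\<psi> s y - u s y) t x \<le> 0"
  proof (rule parabolic_max_principle[where w = "\<lambda>s y. ?\<psi> s y - u s y" and t = t and x = x
        and D = ?D and ?T0.0 = T and ?T1.0 = t and N = \<delta> and K = 0])
    have "?D = {p. T \<le> fst p} \<inter> {p. fst p \<le> t} \<inter> {p. X T + \<sigma> * (fst p - T) \<le> snd p} \<inter> {p. snd p \<le> X (fst p)}"
      by auto
    moreover have "closed \<dots>" by (intro closed_Int closed_Collect_le continuous_intros cX)
    ultimately show "closed ?D" by simp
    show "continuous_on ?D (\<lambda>(t, x). ?\<psi> t x - u t x)"
      unfolding case_prod_unfold using cont by (intro continuous_intros) (auto simp: case_prod_unfold)
  next
    fix s y assume "(s, y) \<in> ?D"
    then show "?\<psi> s y - u s y \<le> \<delta>" using range[of s y] \<psi>_le[where s = s and y = y] T by auto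
  next
    fix s y assume D: "(s, y) \<in> ?D" and pos: "0 < ?\<psi> s y - u s y"
    have D': "T \<le> s" "s \<le> t" "X T + \<sigma> * (s - T) \<le> y" "y \<le> X s" using D by auto
    have u: "0 \<le> u s y" "u s y \<le> 1" using range[of s y] D' T by auto
    have left: "X T + \<sigma> * (s - T) \<noteq> y" using pos u by auto
    have right: "y \<noteq> X s" using front[OF D'(1)] \<psi>_le[where s = s and y = y] pos by auto
    \<comment> \<open>At time \<open>T\<close> the region is the single point \<open>X T\<close>, so
      the initial part of the parabolic boundary is already covered by the lateral cases.\<close>
    have "s \<noteq> T" using left right D' by auto
    then have s: "T < s" using D' by simp
    let ?U = "{p. T < fst p} \<inter> {p. X T + \<sigma> * (fst p - T) < snd p} \<inter> {p. snd p < X (fst p)}"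
    have "open ?U" by (intro open_Int open_Collect_less continuous_intros cX)
    then have nbhd: "\<exists>U. open U \<and> (s, y) \<in> U \<and> (\<forall>s' y'. (s', y') \<in> U \<longrightarrow> s' \<le> s \<longrightarrow> (s', y') \<in> ?D)"
      using s left right D' by (intro exI[of _ ?U]) auto
    obtain ut uxx where d: "parabolic_derivs u s y ut uxx" "ut = uxx + f (u s y)"
      using rd_solution_parabolic[OF sol, of s y] s T by auto
    let ?e = "exp (- \<sigma> * (y - X T - \<sigma> * (s - T)))"
    have \<psi>d: "parabolic_derivs ?\<psi> s y (- \<delta> * \<sigma>\<^sup>2 * ?e) (- \<delta> * \<sigma>\<^sup>2 * ?e)"
      by (rule parabolic_derivs_globalI[where wx = "\<lambda>y. \<delta> * \<sigma> * exp (- \<sigma> * (y - X T - \<sigma> * (s - T)))"])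
        (auto intro!: derivative_eq_intros simp: power2_eq_square)
    have "- \<delta> * \<sigma>\<^sup>2 * ?e - ut \<le> - \<delta> * \<sigma>\<^sup>2 * ?e - uxx + 0 * (?\<psi> s y - u s y)"
      using d(2) f[OF u] by simp
    then show "(\<exists>U. open U \<and> (s, y) \<in> U \<and> (\<forall>s' y'. (s', y') \<in> U \<longrightarrow> s' \<le> s \<longrightarrow> (s', y') \<in> ?D)) \<and>
       (\<exists>wt wxx. parabolic_derivs (\<lambda>s y. ?\<psi> s y - u s y) s y wt wxx \<and>
           wt \<le> wxx + 0 * (?\<psi> s y - u s y))"
      using nbhd parabolic_derivs_diff[OF \<psi>d d(1)] by blast
  qed (use t x in auto)
  then show ?thesis by simp
qed

text \<open>The barrier satisfies psi_t = psi_xx + mu, with mu split equally between growth in time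
  and curvature in space. Where psi > u, the bound psi <= m gives u <= m and the window gives d <=
  u, so the reaction is at least \<open>\<mu>\<close> exactly where the comparison needs it.\<close>

lemma growth_on_window:
  assumes sol: "rd_solution f u0 u"
    and range: "\<And>t x. t \<ge> 0 \<Longrightarrow> 0 \<le> u t x"
    and \<mu>: "\<mu> > 0" and f: "\<And>s. d \<le> s \<Longrightarrow> s \<le> m \<Longrightarrow> \<mu> \<le> f s"
    and m: "m > 0" and t0: "t0 > 0"
    and window: "\<And>s y. t0 \<le> s \<Longrightarrow> s \<le> t0 + 2 * m / \<mu> \<Longrightarrow> \<bar>y - a\<bar> \<le> 2 * sqrt (m / \<mu>) \<Longrightarrow> d \<le> u s y"
  shows "m \<le> u (t0 + 2 * m / \<mu>) a"
proof -
  \<comment> \<open>On the window the comparison paraboloid \<open>?\<psi>\<close> is nonpositive initially and laterally, and its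
    apex reaches \<open>m\<close> at time \<open>t0 + \<tau>\<close>.\<close>
  define \<tau> where "\<tau> = 2 * m / \<mu>"
  define L where "L = 2 * sqrt (m / \<mu>)"
  have L: "\<mu> / 4 * L\<^sup>2 = m" and L0: "L > 0" using m \<mu> by (simp_all add: L_def power_mult_distrib)
  have \<tau>: "\<mu> / 2 * \<tau> = m" and \<tau>0: "\<tau> > 0" using m \<mu> by (simp_all add: \<tau>_def)
  let ?\<psi> = "\<lambda>s y. \<mu> / 2 * (s - t0) - \<mu> / 4 * (y - a)\<^sup>2"
  let ?D = "{t0..t0 + \<tau>} \<times> {a - L..a + L}"
  have cont: "continuous_on ?D (\<lambda>p. u (fst p) (snd p))"
    by (rule rd_solution_continuous[OF sol]) (use t0 in auto)
  have \<psi>_le: "?\<psi> s y \<le> m" if "s \<le> t0 + \<tau>" for s y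
  proof -
    have "\<mu> / 2 * (s - t0) \<le> \<mu> / 2 * \<tau>" using that \<mu> by (intro mult_left_mono) auto
    moreover have "\<mu> / 4 * (y - a)\<^sup>2 \<ge> 0" using \<mu> by simp
    ultimately show ?thesis using \<tau> by linarith
  qed
  have "(\<lambda>s y. ?\<psi> s y - u s y) (t0 + \<tau>) a \<le> 0"
  proof (rule parabolic_max_principle[where w = "\<lambda>s y. ?\<psi> s y - u s y" and t = "t0 + \<tau>" and x = a
        and D = ?D and ?T0.0 = t0 and ?T1.0 = "t0 + \<tau>" and N = m and K = 0])
    show "closed ?D" by (intro closed_Times) auto
    show "continuous_on ?D (\<lambda>(t, x). ?\<psi> t x - u t x)"
      unfolding case_prod_unfold using cont by (intro continuous_intros)
  next
    fix s y assume "(s, y) \<in> ?D"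
    then show "?\<psi> s y - u s y \<le> m" using range[of s y] \<psi>_le[of s y] t0 by auto
  next
    fix s y assume D: "(s, y) \<in> ?D" and pos: "0 < ?\<psi> s y - u s y"
    have D': "t0 \<le> s" "s \<le> t0 + \<tau>" "\<bar>y - a\<bar> \<le> L" using D by auto
    have u: "0 \<le> u s y" using range[of s y] D' t0 by auto
    have du: "d \<le> u s y" using window D' unfolding \<tau>_def L_def by auto
    have um: "u s y \<le> m" using pos \<psi>_le[OF D'(2), of y] by simp
    have "\<mu> / 4 * (y - a)\<^sup>2 \<ge> 0" using \<mu> by simp
    then have "s \<noteq> t0" using pos u by auto
    then have s: "t0 < s" using D' by simp
    have "\<bar>y - a\<bar> \<noteq> L"
    proof
      assume "\<bar>y - a\<bar> = L"
      then have "(y - a)\<^sup>2 = L\<^sup>2" by (metis power2_abs)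
      moreover have "\<mu> / 2 * (s - t0) \<le> \<mu> / 2 * \<tau>" using D' \<mu> by (intro mult_left_mono) auto
      ultimately show False using L \<tau> pos u by simp
    qed
    then have y: "a - L < y" "y < a + L" using D' by auto
    let ?U = "{t0<..} \<times> {a - L<..<a + L}"
    have "open ?U" by (intro open_Times) auto
    then have nbhd: "\<exists>U. open U \<and> (s, y) \<in> U \<and> (\<forall>s' y'. (s', y') \<in> U \<longrightarrow> s' \<le> s \<longrightarrow> (s', y') \<in> ?D)"
      using s y D' by (intro exI[of _ ?U]) auto
    obtain ut uxx where d: "parabolic_derivs u s y ut uxx" "ut = uxx + f (u s y)"
      using rd_solution_parabolic[OF sol, of s y] s t0 by auto
    have \<psi>d: "parabolic_derivs ?\<psi> s y (\<mu> / 2) (- \<mu> / 2)"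
      by (rule parabolic_derivs_globalI[where wx = "\<lambda>y. - \<mu> / 2 * (y - a)"])
        (auto intro!: derivative_eq_intros)
    have "\<mu> / 2 - ut \<le> - \<mu> / 2 - uxx + 0 * (?\<psi> s y - u s y)"
      using d(2) f[OF du um] by simp
    then show "(\<exists>U. open U \<and> (s, y) \<in> U \<and> (\<forall>s' y'. (s', y') \<in> U \<longrightarrow> s' \<le> s \<longrightarrow> (s', y') \<in> ?D)) \<and>
       (\<exists>wt wxx. parabolic_derivs (\<lambda>s y. ?\<psi> s y - u s y) s y wt wxx \<and>
           wt \<le> wxx + 0 * (?\<psi> s y - u s y))"
      using nbhd parabolic_derivs_diff[OF \<psi>d d(1)] by blast
  qed (use \<tau>0 L0 in auto)
  then show ?thesis using \<tau> by (simp add: \<tau>_def)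
qed

section \<open>The profile near the logarithmically corrected front\<close>

text \<open>The shift (nu/lam) ln t turns the exponential factor into t^(-nu) exp(-lam q), which
  normalises the power factor to a ratio that tends to c - b for fixed \<open>q\<close>.\<close>

lemma tail_profile_at_front:
  assumes "t > 0" "lam > 0" and x: "x = c * t + \<nu> / lam * ln t + q" and "x - b * t > 0"
  shows "tail_profile c b lam \<nu> t x = ((x - b * t) / t) powr \<nu> * exp (- lam * q)"
proof -
  have eq: "- lam * (x - c * t) = - \<nu> * ln t + - lam * q" using assms by (simp add: field_simps)
  have exp_eq: "exp (- lam * (x - c * t)) = t powr - \<nu> * exp (- lam * q)"
    unfolding eq exp_add using assms(1) by (simp add: powr_def)
  show ?thesis unfolding tail_profile_def exp_eq
    using assms(1,4) by (simp add: powr_divide powr_minus divide_simps)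
qed

text \<open>At offset \<open>q\<close> ahead of the front, the ratio (x - b t)/t lies between k/2
  and k1 + q for all large t. The profile is therefore bounded by a function of \<open>q\<close>
  alone, which decays exponentially up to powers.\<close>

lemma small_ahead_of_front:
  fixes \<nu> lam b c C m s0 :: real
  assumes lam: "lam > 0" and b: "b < c" and C: "C \<ge> 0" and m: "m > 0" and s0: "s0 > 0"
    and bound: "\<And>t x. t \<ge> 0 \<Longrightarrow> x - b * t \<ge> s0 \<Longrightarrow> u t x \<le> C * tail_profile c b lam \<nu> t x"
  shows "\<exists>T B. \<forall>t\<ge>T. \<forall>x \<ge> c * t + \<nu> / lam * ln t + B. u t x < m"
proof -
  define k where "k = c - b"
  define k1 where "k1 = k + \<bar>\<nu> / lam\<bar>"
  have k: "k > 0" using b by (simp add: k_def)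
  have k1: "k1 > 0" using k by (simp add: k1_def add_pos_nonneg)
  have "((\<lambda>q. (k / 2) powr \<nu> * exp (- lam * q)) \<longlongrightarrow> 0) at_top" using lam k by real_asymp
  moreover have "((\<lambda>q. (k1 + q) powr \<nu> * exp (- lam * q)) \<longlongrightarrow> 0) at_top" using lam k1 by real_asymp
  ultimately have "((\<lambda>q. C * ((k / 2) powr \<nu> * exp (- lam * q) + (k1 + q) powr \<nu> * exp (- lam * q)))
      \<longlongrightarrow> C * (0 + 0)) at_top"
    by (intro tendsto_intros)
  then have "\<forall>\<^sub>F q in at_top. C * ((k / 2) powr \<nu> * exp (- lam * q) + (k1 + q) powr \<nu> * exp (- lam * q)) < m"
    using m by (intro order_tendstoD(2)) auto
  then obtain B0 where B0: "\<And>q. q \<ge> B0 \<Longrightarrow>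
      C * ((k / 2) powr \<nu> * exp (- lam * q) + (k1 + q) powr \<nu> * exp (- lam * q)) < m"
    by (auto simp: eventually_at_top_linorder)
  \<comment> \<open>Only half of the linear growth is spent on exceeding \<open>s0\<close> and the
    logarithm; the other half gives the lower bound k/2 on the ratio.\<close>
  have "filterlim (\<lambda>t. k * t / 2 + \<nu> / lam * ln t) at_top at_top" using k by real_asymp
  then have "\<forall>\<^sub>F t in at_top. s0 \<le> k * t / 2 + \<nu> / lam * ln t" by (simp add: filterlim_at_top)
  then obtain T0 where T0: "\<And>t. t \<ge> T0 \<Longrightarrow> s0 \<le> k * t / 2 + \<nu> / lam * ln t"
    by (auto simp: eventually_at_top_linorder)
  have "u t x < m" if t: "t \<ge> max T0 1" and x: "x \<ge> c * t + \<nu> / lam * ln t + max B0 0" for t x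
  proof -
    define q where "q = x - (c * t + \<nu> / lam * ln t)"
    have q: "q \<ge> 0" "q \<ge> B0" using x by (auto simp: q_def)
    have t': "t \<ge> 1" "t \<ge> T0" using t by auto
    define s where "s = x - b * t"
    have s_eq: "s = k * t + \<nu> / lam * ln t + q" by (simp add: s_def q_def k_def algebra_simps)
    have kt: "k * t > 0" using k t' by auto
    have s: "s \<ge> s0" "s \<ge> k * t / 2" using T0[OF t'(2)] s_eq q s0 kt by linarith+
    have lower: "k / 2 \<le> s / t" using s(2) t' by (simp add: field_simps)
    then have st: "0 \<le> s / t" using k by linarith
    have "\<nu> / lam * ln t \<le> \<bar>\<nu> / lam\<bar> * t"
      using t' ln_le_minus_one[of t] by (intro mult_mono abs_ge_self) auto
    moreover have "q \<le> q * t" using q t' by (simp add: mult_le_cancel_left1)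
    ultimately have "s \<le> (k1 + q) * t" unfolding s_eq k1_def by (simp only: distrib_right)
    then have upper: "s / t \<le> k1 + q" using t' by (simp add: divide_le_eq)
    \<comment> \<open>The sum covers both signs of \<open>\<nu>\<close>: the power is increasing for
      nu >= 0 and decreasing for nu < 0.\<close>
    have pow: "(s / t) powr \<nu> \<le> (k / 2) powr \<nu> + (k1 + q) powr \<nu>"
    proof (cases "\<nu> \<ge> 0")
      case True
      then have "(s / t) powr \<nu> \<le> (k1 + q) powr \<nu>" using upper st by (intro powr_mono2)
      then show ?thesis by (simp add: add_increasing)
    next
      case False
      then have "(s / t) powr \<nu> \<le> (k / 2) powr \<nu>" using lower k by (intro powr_mono2') auto
      then show ?thesis by (simp add: add_increasing2)
    qed
    have "u t x \<le> C * tail_profile c b lam \<nu> t x" using bound s(1) t' by (simp add: s_def)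
    also have "tail_profile c b lam \<nu> t x = (s / t) powr \<nu> * exp (- lam * q)"
      unfolding s_def using tail_profile_at_front[of t lam x c \<nu> q b] t' lam s s0 by (simp add: q_def s_def)
    also have "C * ((s / t) powr \<nu> * exp (- lam * q)) \<le>
        C * (((k / 2) powr \<nu> + (k1 + q) powr \<nu>) * exp (- lam * q))"
      using pow C by (intro mult_left_mono mult_right_mono) auto
    also have "\<dots> < m" using B0[OF q(2)] by (simp add: distrib_right)
    finally show ?thesis .
  qed
  then show ?thesis by blast
qed

lemma positive_on_front:
  fixes \<nu> lam b c a A \<theta> s0 :: real
  assumes lam: "lam > 0" and b: "b < c" and a: "0 < a" "a \<le> A" and \<theta>: "\<theta> > 0" and s0: "s0 > 0"
    and bound: "\<And>t x. t \<ge> 0 \<Longrightarrow> x - b * t \<ge> s0 \<Longrightarrow>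
       a * tail_profile c b lam \<nu> t x - A * tail_profile c b lam \<nu> t x powr (1 + \<theta>) \<le> u t x"
  shows "\<exists>\<delta>>0. \<exists>T>0. \<exists>B. \<forall>t\<ge>T. \<delta> \<le> u t (c * t + \<nu> / lam * ln t - B)"
proof -
  define k where "k = c - b"
  have k: "k > 0" using b by (simp add: k_def)
  \<comment> \<open>\<open>y\<close> satisfies \<open>a * y - A * y powr (1 + \<theta>) = a * y / 2\<close>, and \<open>B\<close> is chosen so that the profile
    tends to \<open>y\<close> along the curve.\<close>
  define y where "y = (a / (2 * A)) powr (1 / \<theta>)"
  have A: "A > 0" using a by simp
  have y: "y > 0" "y powr \<theta> = a / (2 * A)" using a A \<theta> by (simp_all add: y_def powr_powr)
  define B where "B = ln (y / k powr \<nu>) / lam"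
  have B: "k powr \<nu> * exp (lam * B) = y" using lam y k by (simp add: B_def)
  define Y where "Y = (\<lambda>t. ((k * t + \<nu> / lam * ln t - B) / t) powr \<nu> * exp (lam * B))"
  have "((\<lambda>t. (k * t + \<nu> / lam * ln t - B) / t) \<longlongrightarrow> k) at_top" by real_asymp
  then have "(Y \<longlongrightarrow> k powr \<nu> * exp (lam * B)) at_top" unfolding Y_def using k by (intro tendsto_intros) auto
  then have "(Y \<longlongrightarrow> y) at_top" by (simp add: B)
  then have "((\<lambda>t. a * Y t - A * Y t powr (1 + \<theta>)) \<longlongrightarrow> a * y - A * y powr (1 + \<theta>)) at_top"
    using y by (intro tendsto_intros) auto
  moreover have "a * y - A * y powr (1 + \<theta>) = a * y / 2"
    using y A by (simp add: powr_add field_simps)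
  moreover have "a * y / 4 < a * y / 2" using a y by simp
  ultimately have "\<forall>\<^sub>F t in at_top. a * y / 4 < a * Y t - A * Y t powr (1 + \<theta>)"
    by (intro order_tendstoD(1)) auto
  moreover have "filterlim (\<lambda>t. k * t + \<nu> / lam * ln t - B) at_top at_top" using k by real_asymp
  then have "\<forall>\<^sub>F t in at_top. s0 \<le> k * t + \<nu> / lam * ln t - B" by (simp add: filterlim_at_top)
  ultimately have "\<forall>\<^sub>F t in at_top. a * y / 4 < a * Y t - A * Y t powr (1 + \<theta>) \<and>
     s0 \<le> k * t + \<nu> / lam * ln t - B"
    by eventually_elim auto
  then obtain T0 where T0: "\<And>t. t \<ge> T0 \<Longrightarrow> a * y / 4 < a * Y t - A * Y t powr (1 + \<theta>) \<and>
     s0 \<le> k * t + \<nu> / lam * ln t - B" by (auto simp: eventually_at_top_linorder)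
  have "a * y / 4 \<le> u t (c * t + \<nu> / lam * ln t - B)" if t: "t \<ge> max T0 1" for t
  proof -
    define x where "x = c * t + \<nu> / lam * ln t - B"
    have s: "x - b * t = k * t + \<nu> / lam * ln t - B" by (simp add: x_def k_def algebra_simps)
    have s_ge: "x - b * t \<ge> s0" using T0[of t] t s by simp
    have "tail_profile c b lam \<nu> t x = Y t"
      using tail_profile_at_front[of t lam x c \<nu> "- B" b] t lam s_ge s0 unfolding s
      by (simp add: x_def Y_def)
    then show ?thesis using T0[of t] bound[OF _ s_ge] t by (simp add: x_def)
  qed
  then show ?thesis using a y
    by (intro exI[of _ "a * y / 4"] conjI exI[of _ "max T0 1"] exI[of _ B]) auto
qed

text \<open>The wave of \<open>spreading_behind_front\<close> is given half the speed of the front,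
  so the zone where u >= delta/2 widens linearly and eventually contains a fixed window behind the
  front throughout a time span \<open>\<tau>\<close>. There \<open>growth_on_window\<close> lifts u
  to \<open>m\<close>, using the positive minimum of \<open>f\<close> on
  \<open>{d..m}\<close>.\<close>

lemma level_behind_front:
  fixes \<nu> lam c :: real
  assumes sol: "rd_solution f u0 u"
    and range: "\<And>t x. t \<ge> 0 \<Longrightarrow> 0 \<le> u t x \<and> u t x \<le> 1"
    and f_nonneg: "\<And>s. 0 \<le> s \<Longrightarrow> s \<le> 1 \<Longrightarrow> 0 \<le> f s"
    and f_pos: "\<And>s. 0 < s \<Longrightarrow> s < 1 \<Longrightarrow> 0 < f s" and f_cont: "continuous_on {0..1} f"
    and c: "c > 0" and \<delta>: "\<delta> > 0" and T: "T > 0"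
    and front: "\<And>t. t \<ge> T \<Longrightarrow> \<delta> \<le> u t (c * t + \<nu> / lam * ln t - B)"
    and m: "0 < m" "m < 1"
  shows "\<exists>T' B'. \<forall>t\<ge>T'. m \<le> u t (c * t + \<nu> / lam * ln t - B')"
proof -
  define n where "n = \<nu> / lam"
  define X where "X = (\<lambda>t. c * t + n * ln t - B)"
  define \<sigma> where "\<sigma> = c / 2"
  have \<sigma>: "\<sigma> > 0" using c by (simp add: \<sigma>_def)
  have behind: "\<delta> / 2 \<le> u t x"
    if t: "t \<ge> T" and x: "X T + \<sigma> * (t - T) + ln 2 / \<sigma> \<le> x" "x \<le> X t" for t x
  proof -
    \<comment> \<open>Freezing the curve before \<open>T\<close> makes it continuous on the whole
      line, as the logarithm is not, and changes nothing at later times.\<close>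
    let ?X = "\<lambda>s. X (max T s)"
    have "ln 2 / \<sigma> \<ge> 0" using \<sigma> by simp
    then have x': "X T + \<sigma> * (t - T) \<le> x" using x by linarith
    have "continuous_on UNIV ?X" unfolding X_def using T by (intro continuous_intros) auto
    from spreading_behind_front[OF sol range f_nonneg this T _ _ t, of \<delta> \<sigma> x]
    have *: "\<delta> * (1 - exp (- \<sigma> * (x - X T - \<sigma> * (t - T)))) \<le> u t x"
      using front \<delta> x' x(2) t by (simp add: X_def n_def)
    \<comment> \<open>At distance ln 2 / sigma from its zero the wave has reached half of its limit
      \<open>\<delta>\<close>.\<close>
    have "ln 2 / \<sigma> \<le> x - X T - \<sigma> * (t - T)" using x by simp
    then have "ln 2 \<le> \<sigma> * (x - X T - \<sigma> * (t - T))" using \<sigma> by (simp add: pos_divide_le_eq mult.commute)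
    then have "exp (- \<sigma> * (x - X T - \<sigma> * (t - T))) \<le> exp (- ln 2)" by simp
    also have "\<dots> = (1 / 2 :: real)" by (simp add: exp_minus)
    finally have "\<delta> * (1 / 2) \<le> \<delta> * (1 - exp (- \<sigma> * (x - X T - \<sigma> * (t - T))))"
      using \<delta> by (intro mult_left_mono) auto
    with * show ?thesis by simp
  qed
  define d where "d = min (\<delta> / 2) m"
  have d: "0 < d" "d \<le> m" "d \<le> \<delta> / 2" using \<delta> m by (auto simp: d_def)
  have "continuous_on {d..m} f" by (rule continuous_on_subset[OF f_cont]) (use d m in auto)
  then obtain z where z: "z \<in> {d..m}" "\<And>s. s \<in> {d..m} \<Longrightarrow> f z \<le> f s"
    using continuous_attains_inf[of "{d..m}" f] d by auto
  define \<mu> where "\<mu> = f z"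
  have \<mu>: "\<mu> > 0" unfolding \<mu>_def using f_pos z(1) d m by auto
  have f_ge: "\<mu> \<le> f s" if "d \<le> s" "s \<le> m" for s using z(2)[of s] that by (simp add: \<mu>_def)
  define \<tau> where "\<tau> = 2 * m / \<mu>"
  define L where "L = 2 * sqrt (m / \<mu>)"
  have \<tau>: "\<tau> > 0" using m \<mu> by (simp add: \<tau>_def)
  \<comment> \<open>The window has half-width \<open>L\<close>, and during the last time
    \<open>\<tau>\<close> the front advances by at most c tau + |n| ln 2. Staying \<open>S\<close>
    behind its final position thus keeps the whole window behind the front during that span.\<close>
  define S where "S = L + c * \<tau> + \<bar>n\<bar> * ln 2"
  have "filterlim (\<lambda>t. X t - S - L - (X T + \<sigma> * (t - T) + ln 2 / \<sigma>)) at_top at_top"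
    unfolding X_def \<sigma>_def using c by real_asymp
  then have "\<forall>\<^sub>F t in at_top. 0 \<le> X t - S - L - (X T + \<sigma> * (t - T) + ln 2 / \<sigma>)"
    unfolding filterlim_at_top by (rule spec)
  then have "\<forall>\<^sub>F t in at_top. X T + \<sigma> * (t - T) + ln 2 / \<sigma> \<le> X t - S - L"
    by eventually_elim linarith
  then obtain T0 where T0: "\<And>t. t \<ge> T0 \<Longrightarrow> X T + \<sigma> * (t - T) + ln 2 / \<sigma> \<le> X t - S - L"
    by (auto simp: eventually_at_top_linorder)
  \<comment> \<open>Waiting until T + 2 tau ensures s >= T and t <= 2 s for every s in [t - tau, t],
    which bounds ln t - ln s by ln 2.\<close>
  have "m \<le> u t (c * t + \<nu> / lam * ln t - (B + S))" if t: "t \<ge> max T0 (T + 2 * \<tau>)" for t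
  proof -
    have "m \<le> u (t - \<tau> + 2 * m / \<mu>) (X t - S)"
    proof (rule growth_on_window[OF sol _ \<mu> f_ge m(1)])
      show "t - \<tau> > 0" using t T \<tau> by auto
      fix s y assume s: "t - \<tau> \<le> s" "s \<le> t - \<tau> + 2 * m / \<mu>" and "\<bar>y - (X t - S)\<bar> \<le> 2 * sqrt (m / \<mu>)"
      then have y: "X t - S - L \<le> y" "y \<le> X t - S + L" unfolding L_def by linarith+
      have s': "s \<le> t" using s by (simp add: \<tau>_def)
      have sT: "s \<ge> T" "s \<ge> t / 2" "s > 0" using s t \<tau> T by auto
      have "\<sigma> * (s - T) \<le> \<sigma> * (t - T)" using s' \<sigma> by (intro mult_left_mono) auto
      then have "X T + \<sigma> * (s - T) + ln 2 / \<sigma> \<le> y" using T0[of t] t y by simp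
      moreover have "y \<le> X s"
      proof -
        have "ln t \<le> ln (2 * s)" using sT s' by (intro ln_mono) auto
        then have "ln t - ln s \<le> ln 2" using sT by (simp add: ln_mult)
        moreover have "ln s \<le> ln t" using sT s' by (intro ln_mono) auto
        ultimately have "\<bar>n\<bar> * \<bar>ln t - ln s\<bar> \<le> \<bar>n\<bar> * ln 2" by (intro mult_left_mono) auto
        then have "n * (ln t - ln s) \<le> \<bar>n\<bar> * ln 2"
          by (metis abs_le_D1 abs_mult)
        moreover have "c * (t - s) \<le> c * \<tau>" using c s by (intro mult_left_mono) auto
        moreover have "X t - X s = c * (t - s) + n * (ln t - ln s)" by (simp add: X_def algebra_simps)
        ultimately show ?thesis using y unfolding S_def by linarith
      qed
      ultimately show "d \<le> u s y" using behind[of s y] sT d by simp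
    qed (use range in auto)
    then show ?thesis by (simp add: \<tau>_def X_def n_def algebra_simps)
  qed
  then show ?thesis by blast
qed


section \<open>Quadratic bound on the reaction, choice of constants and conclusion\<close>

text \<open>Two applications of the mean value theorem, first to f' and then to f, with
  \<open>M\<close> a bound for |f''| on the compact interval.\<close>

lemma KPP_quadratic_lower_bound:
  fixes f f' f'' :: "real \<Rightarrow> real"
  assumes f_C2: "\<forall>s\<in>{0..1}. (f has_real_derivative f' s) (at s within {0..1})
                          \<and> (f' has_real_derivative f'' s) (at s within {0..1})"
    and f''_cont: "continuous_on {0..1} f''" and f0: "f 0 = 0"
  obtains M where "M \<ge> 0" "\<And>s. 0 \<le> s \<Longrightarrow> s \<le> 1 \<Longrightarrow> f' 0 * s - M * s\<^sup>2 \<le> f s"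
proof -
  have "compact (f'' ` {0..1})" by (intro compact_continuous_image f''_cont) auto
  then obtain M where M: "\<And>s. s \<in> {0..1} \<Longrightarrow> \<bar>f'' s\<bar> \<le> M"
    using compact_imp_bounded bounded_iff by (metis image_eqI real_norm_def)
  have M0: "M \<ge> 0" using M[of 0] by force
  have f'_ge: "f' 0 - M * s \<le> f' s" if "0 < s" "s \<le> 1" for s
  proof -
    have "\<exists>z\<in>{0<..<s}. f' s - f' 0 = (\<lambda>h. f'' z * h) (s - 0)"
    proof (rule mvt_simple[OF that(1)])
      fix z assume "0 \<le> z" "z \<le> s"
      then have "(f' has_real_derivative f'' z) (at z within {0..1})" using f_C2 that by auto
      then have "(f' has_real_derivative f'' z) (at z within {0..s})"
        by (rule DERIV_subset) (use that in auto)
      then show "(f' has_derivative (\<lambda>h. f'' z * h)) (at z within {0..s})"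
        by (simp add: has_field_derivative_def)
    qed
    then obtain z where z: "z \<in> {0<..<s}" "f' s - f' 0 = f'' z * s" by auto
    have "- M \<le> f'' z" using M[of z] z that by auto
    then have "- M * s \<le> f'' z * s" using that by (intro mult_right_mono) auto
    then show ?thesis using z by simp
  qed
  have "f' 0 * s - M * s\<^sup>2 \<le> f s" if "0 \<le> s" "s \<le> 1" for s
  proof (cases "s = 0")
    case False
    then have s: "0 < s" using that by simp
    have "\<exists>z\<in>{0<..<s}. f s - f 0 = (\<lambda>h. f' z * h) (s - 0)"
    proof (rule mvt_simple[OF s])
      fix z assume "0 \<le> z" "z \<le> s"
      then have "(f has_real_derivative f' z) (at z within {0..1})" using f_C2 that by auto
      then have "(f has_real_derivative f' z) (at z within {0..s})"
        by (rule DERIV_subset) (use that in auto)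
      then show "(f has_derivative (\<lambda>h. f' z * h)) (at z within {0..s})"
        by (simp add: has_field_derivative_def)
    qed
    then obtain z where z: "z \<in> {0<..<s}" "f s = f' z * s" using f0 by auto
    have "M * z \<le> M * s" using z M0 by (intro mult_left_mono) auto
    then have "f' 0 - M * s \<le> f' z" using f'_ge[of z] z that by auto
    then have "(f' 0 - M * s) * s \<le> f' z * s" using s by (intro mult_right_mono) auto
    then show ?thesis using z by (simp add: algebra_simps power2_eq_square)
  qed (use f0 in auto)
  with M0 that show thesis by blast
qed

theorem theorem1p2:
  fixes f f' f'' :: "real \<Rightarrow> real"
    and u0 :: "real \<Rightarrow> real" and u :: "real \<Rightarrow> real \<Rightarrow> real"
    and lam \<nu> a1 a2 c :: real
  assumes f_C2: "\<forall>s\<in>{0..1}. (f has_real_derivative f' s) (at s within {0..1})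
                          \<and> (f' has_real_derivative f'' s) (at s within {0..1})"
      and f''_cont: "continuous_on {0..1} f''"
      and f0: "f 0 = 0" and f1: "f 1 = 0"
      and f_KPP: "\<forall>s\<in>{0<..<1}. 0 < f s \<and> f s \<le> f' 0 * s"
      and f_ext_left: "\<forall>s<0. f s = f' 0 * s"
      and f_ext_right: "\<forall>s>1. f s = f' 1 * (s - 1)"
      and lam_pos: "0 < lam" "lam < sqrt (f' 0)"
      and c_def: "c = lam + f' 0 / lam"
      and u0_cont: "continuous_on UNIV u0"
      and u0_range: "\<forall>x. 0 \<le> u0 x \<and> u0 x \<le> 1"
      and u0_nonzero: "\<exists>x. u0 x \<noteq> 0"
      and a: "0 < a1" "a1 \<le> a2"
      and u0_tail: "\<exists>x0. \<forall>x\<ge>x0. a1 * x powr \<nu> * exp (- lam * x) \<le> u0 x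
                                 \<and> u0 x \<le> a2 * x powr \<nu> * exp (- lam * x)"
      and sol: "rd_solution f u0 u"
  shows "\<forall>m\<in>{0<..<1}. \<exists>T B. \<forall>t\<ge>T.
           \<bar>level_pos u m t - c * t - (\<nu> / lam) * ln t\<bar> \<le> B"
proof -
  define r where "r = f' 0"
  have "0 < sqrt r" using lam_pos unfolding r_def by linarith
  then have r: "r > 0" by simp
  have "lam\<^sup>2 < (sqrt r)\<^sup>2" using lam_pos by (intro power_strict_mono) (auto simp: r_def)
  then have lam_r: "lam\<^sup>2 < r" using r by simp
  have c_eq: "lam * c - lam\<^sup>2 = r" using lam_pos by (simp add: c_def r_def field_simps power2_eq_square)
  have c: "c > 0" unfolding c_def r_def[symmetric] using lam_pos r by (intro add_pos_pos divide_pos_pos) auto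
  \<comment> \<open>Half the gap between 2 lam and c. The gap is positive because lam (c - 2 lam) =
    r - lam^2, which is where lam < sqrt(f'(0)) enters.\<close>
  define \<epsilon> where "\<epsilon> = (c - 2 * lam) / 2"
  have "lam * (c - 2 * lam) > 0" using c_eq lam_r by (simp add: algebra_simps power2_eq_square)
  then have \<epsilon>: "\<epsilon> > 0" using lam_pos by (simp add: \<epsilon>_def zero_less_mult_iff)
  \<comment> \<open>\<open>b1\<close> serves the supersolution and \<open>b2\<close> the
    subsolution: the sign makes (2 lam - b) nu equal to +epsilon |nu| and -epsilon |nu|
    respectively. For nu = 0 both are 2 lam and the remainder vanishes.\<close>
  define b1 where "b1 = 2 * lam - sgn \<nu> * \<epsilon>"
  define b2 where "b2 = 2 * lam + sgn \<nu> * \<epsilon>"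
  have c_gt: "2 * lam + \<epsilon> < c" using \<epsilon> by (simp add: \<epsilon>_def field_simps)
  have b: "b1 < c" "b2 < c" using c_gt \<epsilon> by (auto simp: b1_def b2_def sgn_if)
  have b1_eq: "(2 * lam - b1) * \<nu> = \<epsilon> * \<bar>\<nu>\<bar>" and b2_eq: "(2 * lam - b2) * \<nu> = - \<epsilon> * \<bar>\<nu>\<bar>"
    by (auto simp: b1_def b2_def sgn_if)
  have range: "0 \<le> u t x \<and> u t x \<le> 1" if "t \<ge> 0" for t x
    using rd_solution_range[OF sol, of "f' 0" "f' 1" t x] u0_range f_ext_left f_ext_right that by auto
  have f_upper: "f s \<le> r * s" and f_nonneg: "0 \<le> f s" if "0 \<le> s" "s \<le> 1" for s
  proof -
    have "s = 0 \<or> s = 1 \<or> s \<in> {0<..<1}" using that by auto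
    then show "f s \<le> r * s" "0 \<le> f s" using f0 f1 r f_KPP by (auto simp: r_def less_imp_le)
  qed
  have f_cont: "continuous_on {0..1} f"
    using f_C2 by (auto intro!: DERIV_continuous_on)
  obtain M where M: "M \<ge> 0" "\<And>s. 0 \<le> s \<Longrightarrow> s \<le> 1 \<Longrightarrow> r * s - M * s\<^sup>2 \<le> f s"
    using KPP_quadratic_lower_bound[OF f_C2 f''_cont f0] unfolding r_def by blast
  obtain x0 where x0: "\<And>x. x \<ge> x0 \<Longrightarrow> a1 * (x powr \<nu> * exp (- lam * x)) \<le> u0 x
                     \<and> u0 x \<le> a2 * (x powr \<nu> * exp (- lam * x))"
    using u0_tail by (metis mult.assoc)

  \<comment> \<open>The bound lam theta <= epsilon keeps gamma = lam (1 + theta) strictly between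
    the roots lam and c - lam of gamma c - gamma^2 = r, so the surplus is positive.
    \<open>\<kappa>\<close> is half of it; the other half absorbs the remainder for s >=
    \<open>s1\<close>.\<close>
  define \<theta> where "\<theta> = min 1 (\<epsilon> / lam)"
  have \<theta>: "0 < \<theta>" "\<theta> \<le> 1" using \<epsilon> lam_pos by (auto simp: \<theta>_def)
  define \<gamma> where "\<gamma> = lam * (1 + \<theta>)"
  define \<beta> where "\<beta> = \<nu> * (1 + \<theta>)"
  define \<kappa> where "\<kappa> = (\<gamma> * c - \<gamma>\<^sup>2 - r) / 2"
  have "lam * \<theta> \<le> \<epsilon>" using lam_pos by (simp add: \<theta>_def min_def field_simps)
  then have "c - 2 * lam - lam * \<theta> > 0" using c_gt by simp
  then have "lam * \<theta> * (c - 2 * lam - lam * \<theta>) > 0" using lam_pos \<theta> by simp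
  then have \<kappa>: "\<kappa> > 0"
    unfolding \<kappa>_def \<gamma>_def c_eq[symmetric] by (simp add: algebra_simps power2_eq_square)
  have "((\<lambda>s. ((2 * \<gamma> - b2) * \<beta> * s - \<beta> * (\<beta> - 1)) / s\<^sup>2) \<longlongrightarrow> 0) at_top" by real_asymp
  then have "\<forall>\<^sub>F s in at_top. - \<kappa> < ((2 * \<gamma> - b2) * \<beta> * s - \<beta> * (\<beta> - 1)) / s\<^sup>2"
    using \<kappa> by (intro order_tendstoD(1)) auto
  then obtain s1 where s1: "\<And>s. s \<ge> s1 \<Longrightarrow> - \<kappa> < ((2 * \<gamma> - b2) * \<beta> * s - \<beta> * (\<beta> - 1)) / s\<^sup>2"
    by (auto simp: eventually_at_top_linorder)

  \<comment> \<open>The entries give, in order, positivity, validity of the initial tail bounds,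
    smallness of the remainder of the correction term, and dominance of epsilon |nu| s over |nu (nu
    - 1)|.\<close>
  define s0 where "s0 = Max {1, x0, s1, \<bar>\<nu> - 1\<bar> / \<epsilon>}"
  have s0: "s0 \<ge> 1" "s0 \<ge> x0" "s0 \<ge> s1" "s0 \<ge> \<bar>\<nu> - 1\<bar> / \<epsilon>" by (simp_all add: s0_def)
  then have s0_pos: "s0 > 0" by simp
  have curv: "\<bar>\<nu> * (\<nu> - 1)\<bar> \<le> \<epsilon> * \<bar>\<nu>\<bar> * s" if "s \<ge> s0" for s
  proof -
    have "\<bar>\<nu> - 1\<bar> / \<epsilon> \<le> s" using that s0 by simp
    then have "\<bar>\<nu> - 1\<bar> \<le> \<epsilon> * s" using \<epsilon> by (simp add: pos_divide_le_eq mult.commute)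
    then have "\<bar>\<nu>\<bar> * \<bar>\<nu> - 1\<bar> \<le> \<bar>\<nu>\<bar> * (\<epsilon> * s)" by (intro mult_left_mono) auto
    then show ?thesis by (simp add: abs_mult mult_ac)
  qed
  define y0 where "y0 = s0 powr \<nu> * exp (- lam * s0)"
  have y0: "y0 > 0" using s0_pos by (simp add: y0_def)

  \<comment> \<open>\<open>a2\<close> handles the initial tail, and \<open>1 / y0\<close> forces C Y
    >= 1 on the lateral boundary.\<close>
  define C where "C = max a2 (1 / y0)"
  have C: "C \<ge> a2" "C \<ge> 1 / y0" by (auto simp: C_def)
  then have C': "C \<ge> 0" "1 \<le> C * y0" using a y0 by (auto simp: divide_le_eq)
  have upper: "u t x \<le> C * tail_profile c b1 lam \<nu> t x" if "t \<ge> 0" "x - b1 * t \<ge> s0" for t x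
  proof (rule upper_tail_bound[OF sol range f_upper c_eq lam_pos(1) _ s0_pos _ C'(1) _ _ that])
    fix x assume "x \<ge> s0"
    then have "u0 x \<le> a2 * (x powr \<nu> * exp (- lam * x))" using x0 s0 by auto
    also have "\<dots> \<le> C * (x powr \<nu> * exp (- lam * x))" using C by (intro mult_right_mono) auto
    finally show "u0 x \<le> C * (x powr \<nu> * exp (- lam * x))" .
  qed (use b curv C' in \<open>auto simp: b1_eq y0_def abs_le_iff\<close>)

  \<comment> \<open>The three entries confine positivity of the barrier to Y <= 1, absorb the
    quadratic loss, and make the barrier nonpositive on the lateral boundary.\<close>
  define A where "A = Max {a1, M * a1\<^sup>2 / \<kappa>, a1 / y0 powr \<theta>}"
  have "A \<ge> a1" "A \<ge> M * a1\<^sup>2 / \<kappa>" "A \<ge> a1 / y0 powr \<theta>" by (simp_all add: A_def)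
  then have A: "a1 \<le> A" "M * a1\<^sup>2 \<le> A * \<kappa>" "a1 \<le> A * y0 powr \<theta>"
    using \<kappa> y0 by (simp_all add: divide_le_eq)
  have lower: "a1 * tail_profile c b2 lam \<nu> t x - A * tail_profile c b2 lam \<nu> t x powr (1 + \<theta>) \<le> u t x"
    if "t \<ge> 0" "x - b2 * t \<ge> s0" for t x
  proof (rule lower_tail_bound[OF sol range M(2) M(1) c_eq lam_pos(1) _ s0_pos _ \<theta> \<gamma>_def \<beta>_def _ a(1)
        A(1,2) A(3)[unfolded y0_def] _ that])
    fix s assume s: "s \<ge> s0"
    show "\<kappa> \<le> \<gamma> * c - \<gamma>\<^sup>2 - r + ((2 * \<gamma> - b2) * \<beta> * s - \<beta> * (\<beta> - 1)) / s\<^sup>2"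
      using s1[of s] s s0 by (simp add: \<kappa>_def field_simps)
    show "(2 * lam - b2) * \<nu> * s \<le> \<nu> * (\<nu> - 1)" using curv[OF s] by (simp add: b2_eq abs_le_iff)
    show "a1 * (s powr \<nu> * exp (- lam * s)) \<le> u0 s" using x0 s s0 by auto
  qed (use b in auto)

  from positive_on_front[OF lam_pos(1) b(2) a(1) A(1) \<theta>(1) s0_pos lower]
  obtain \<delta> T0 B0 where front: "\<delta> > 0" "T0 > 0" "\<And>t. t \<ge> T0 \<Longrightarrow> \<delta> \<le> u t (c * t + \<nu> / lam * ln t - B0)"
    by blast
  show ?thesis
  proof
    fix m :: real assume m: "m \<in> {0<..<1}"
    from small_ahead_of_front[OF lam_pos(1) b(1) C'(1) _ s0_pos upper, of m] m
    obtain T1 B1 where ahead: "\<And>t x. t \<ge> T1 \<Longrightarrow> x \<ge> c * t + \<nu> / lam * ln t + B1 \<Longrightarrow> u t x < m" by auto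
    from level_behind_front[OF sol range f_nonneg _ f_cont c front(1,2,3), of m] m f_KPP
    obtain T2 B2 where behind: "\<And>t. t \<ge> T2 \<Longrightarrow> m \<le> u t (c * t + \<nu> / lam * ln t - B2)" by auto
    have "\<bar>level_pos u m t - c * t - (\<nu> / lam) * ln t\<bar> \<le> max \<bar>B1\<bar> \<bar>B2\<bar>" if t: "t \<ge> max T1 T2" for t
    proof -
      \<comment> \<open>The set is shown to be nonempty and bounded above, so \<open>Sup\<close> is
        a genuine supremum, squeezed between the two offsets.\<close>
      let ?S = "{x. m \<le> u t x}"
      have mem: "c * t + \<nu> / lam * ln t - B2 \<in> ?S" using behind[of t] t by simp
      have le: "x \<le> c * t + \<nu> / lam * ln t + B1" if "x \<in> ?S" for x
        using ahead[of t x] that t by force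
      have "level_pos u m t \<le> c * t + \<nu> / lam * ln t + B1"
        unfolding level_pos_def using mem le by (intro cSup_least) auto
      moreover have "bdd_above ?S" using le by (auto intro!: bdd_aboveI)
      then have "c * t + \<nu> / lam * ln t - B2 \<le> level_pos u m t"
        unfolding level_pos_def using mem by (intro cSup_upper)
      ultimately show ?thesis by (auto simp: abs_le_iff max_def)
    qed
    then show "\<exists>T B. \<forall>t\<ge>T. \<bar>level_pos u m t - c * t - (\<nu> / lam) * ln t\<bar> \<le> B" by blast
  qed
qed

end
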